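(* Let $0<d<1/2$, let $l,\lambda\ge0$, $|m|\le l$, $|\mu|\le\lambda$ be integers and let $\alpha$ be the (real) quasi-periodicity parameter. For $n\in\mathbb Z$ put $\mathbf b_{21}=(-(2d+n),0,0)$. Denote the series $\sum_{n\in\mathbb Z}H_{l,\lambda}^{m,\mu}(\mathbf b_{21})e^{-in\alpha}$ by $\mathscr H_{l,\lambda}^{m,\mu,(21)}(\alpha)$. Then $\mathscr H_{l,\lambda}^{m,\mu,(21)}(\alpha)$ equals $$(-1)^{\lambda+\mu}\sqrt{\frac{2l+1}{2\lambda+1}}\sqrt{\binom{l+\lambda+\mu-m}{\lambda+\mu}\binom{l+\lambda+m-\mu}{\lambda-\mu}}\sqrt{\frac{4\pi}{2(l+\lambda)+1}}$$ $$\times\Big(\Phi(e^{-i\alpha},l+\lambda+1,2d)\,Y_{l+\lambda}^{m-\mu}(\tfrac\pi2,\pi)+e^{i\alpha}\,\Phi(e^{i\alpha},l+\lambda+1,1-2d)\,Y_{l+\lambda}^{m-\mu}(\tfrac\pi2,0)\Big).$$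
   Context: $Y_l^m(\theta,\phi)$ are the $L^2$-orthonormal complex spherical harmonics with Condon–Shortley phase ($\theta$ polar, $\phi$ azimuthal angle). $I_l^m(\mathbf r)=\sqrt{\frac{4\pi}{2l+1}}Y_l^m(\hat{\mathbf r})|\mathbf r|^{-l-1}$, $\hat{\mathbf r}=\mathbf r/|\mathbf r|$, and $H_{l,\lambda}^{m,\mu}(\mathbf b)=(-1)^{\lambda+\mu}\sqrt{\frac{2l+1}{2\lambda+1}}\,I_{l+\lambda}^{m-\mu}(\mathbf b)\sqrt{\binom{l+\lambda+\mu-m}{\lambda+\mu}\binom{l+\lambda+m-\mu}{\lambda-\mu}}$. The Lerch transcendent is defined by the series $\Phi(z,s,c)=\sum_{k=0}^\infty\frac{z^k}{(k+c)^s}$. The number $2d$ is the distance between the centres $(-d,0,0)$ and $(d,0,0)$ of two disjoint balls repeated with period $1$ along the first axis.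
   Formalization: The case l = λ = 0 with α an integer multiple of 2π is excluded, because there the lattice series and both Lerch series diverge and neither side is defined; the sum over n is taken as the limit with independent upper and lower cut-offs. *)

theory Defs
  imports "HOL-Analysis.Analysis" "HOL-Computational_Algebra.Polynomial"
begin

text \<open>Rodrigues' formula.\<close>

definition legendre_poly :: "nat \<Rightarrow> real poly" where
  "legendre_poly l = smult (1 / (2 ^ l * fact l)) ((pderiv ^^ l) ([:-1, 0, 1:] ^ l))"

text \<open>Associated Legendre function of order \<open>m \<ge> 0\<close>, with the Condon--Shortley phase \<open>(-1)\<^sup>m\<close>.\<close>

definition assoc_legendre :: "nat \<Rightarrow> nat \<Rightarrow> real \<Rightarrow> real" where
  "assoc_legendre l m x =
     (-1) ^ m * sqrt (1 - x\<^sup>2) ^ m * poly ((pderiv ^^ m) (legendre_poly l)) x"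

text \<open>Orthonormal complex spherical harmonic of degree \<open>l\<close> and order \<open>m\<close> at polar angle \<open>\<theta>\<close> and
  azimuth \<open>\<phi>\<close>. Negative orders are given by \<open>Y l (-m) = (-1)\<^sup>m * cnj (Y l m)\<close>, which avoids the
  negative powers of \<open>1 - (cos \<theta>)\<^sup>2\<close> that Rodrigues' formula would have at the poles.\<close>

definition sph_harm_nonneg :: "nat \<Rightarrow> nat \<Rightarrow> real \<Rightarrow> real \<Rightarrow> complex" where
  "sph_harm_nonneg l m \<theta> \<phi> =
     of_real (sqrt ((2 * real l + 1) / (4 * pi) * (fact (l - m) / fact (l + m)))
              * assoc_legendre l m (cos \<theta>))
     * exp (\<i> * of_nat m * of_real \<phi>)"

definition sph_harm :: "nat \<Rightarrow> int \<Rightarrow> real \<Rightarrow> real \<Rightarrow> complex" where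
  "sph_harm l m \<theta> \<phi> =
     (if 0 \<le> m then sph_harm_nonneg l (nat m) \<theta> \<phi>
      else (-1) ^ nat (- m) * cnj (sph_harm_nonneg l (nat (- m)) \<theta> \<phi>))"

text \<open>The spherical harmonic as a function of a unit vector. The harmonics are \<open>2\<pi>\<close>-periodic in the
  azimuth, so the branch of \<open>Arg\<close> does not matter; at the poles (where \<open>Arg 0 = 0\<close>) the harmonics
  of nonzero order vanish.\<close>

definition sph_harm_dir :: "nat \<Rightarrow> int \<Rightarrow> real^3 \<Rightarrow> complex" where
  "sph_harm_dir l m u = sph_harm l m (arccos (u $ 3)) (Arg (Complex (u $ 1) (u $ 2)))"

definition irregular_solid :: "nat \<Rightarrow> int \<Rightarrow> real^3 \<Rightarrow> complex" where
  "irregular_solid l m r =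
     of_real (sqrt (4 * pi / (2 * real l + 1))) * sph_harm_dir l m (r /\<^sub>R norm r)
     * of_real (norm r powi (- int l - 1))"

text \<open>For \<open>\<bar>m\<bar> \<le> l\<close> and \<open>\<bar>\<mu>\<bar> \<le> l'\<close> all arguments of \<^const>\<open>nat\<close> below are nonnegative.\<close>

definition translation_coeff ::
    "nat \<Rightarrow> nat \<Rightarrow> int \<Rightarrow> int \<Rightarrow> real^3 \<Rightarrow> complex" where
  "translation_coeff l l' m \<mu> b =
     (-1) powi (int l' + \<mu>)
     * of_real (sqrt ((2 * real l + 1) / (2 * real l' + 1)))
     * irregular_solid (l + l') (m - \<mu>) b
     * of_real (sqrt (real (nat (int l + int l' + \<mu> - m) choose nat (int l' + \<mu>))
                    * real (nat (int l + int l' + m - \<mu>) choose nat (int l' - \<mu>))))"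

text \<open>The Lerch transcendent, as an ordered (possibly only conditionally convergent) series, with the
  principal branch of the power.\<close>

definition lerch_phi :: "complex \<Rightarrow> complex \<Rightarrow> complex \<Rightarrow> complex" where
  "lerch_phi z s c = (\<Sum>k. z ^ k / (of_nat k + c) powr s)"

text \<open>Convergence of a series over \<open>\<int>\<close>: the two cut-offs tend to infinity independently. This is
  weaker than unconditional summability (\<^const>\<open>has_sum\<close>), which would exclude conditionally
  convergent series, and stronger than convergence of the symmetric partial sums.\<close>

definition bilateral_sums :: "(int \<Rightarrow> complex) \<Rightarrow> complex \<Rightarrow> bool" where
  "bilateral_sums f S \<longleftrightarrow>
     ((\<lambda>(M, N). \<Sum>n = - int M..int N. f n) \<longlongrightarrow> S) (sequentially \<times>\<^sub>F sequentially)"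

definition bilateral_summable :: "(int \<Rightarrow> complex) \<Rightarrow> bool" where
  "bilateral_summable f \<longleftrightarrow> (\<exists>S. bilateral_sums f S)"

definition bilateral_suminf :: "(int \<Rightarrow> complex) \<Rightarrow> complex" where
  "bilateral_suminf f = (THE S. bilateral_sums f S)"

definition b21 :: "real \<Rightarrow> int \<Rightarrow> real^3" where
  "b21 d n = vector [- (2 * d + of_int n), 0, 0]"

definition lattice_term ::
    "real \<Rightarrow> nat \<Rightarrow> nat \<Rightarrow> int \<Rightarrow> int \<Rightarrow> real \<Rightarrow> int \<Rightarrow> complex" where
  "lattice_term d l l' m \<mu> \<alpha> n =
     translation_coeff l l' m \<mu> (b21 d n) * exp (- \<i> * of_int n * of_real \<alpha>)"

definition lattice_sum ::
    "real \<Rightarrow> nat \<Rightarrow> nat \<Rightarrow> int \<Rightarrow> int \<Rightarrow> real \<Rightarrow> complex" where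
  "lattice_sum d l l' m \<mu> \<alpha> = bilateral_suminf (lattice_term d l l' m \<mu> \<alpha>)"

end

theory Submission
  imports Defs "HOL-Real_Asymp.Real_Asymp"
begin

text \<open>
  All lattice vectors lie on the first coordinate axis, so \<^const>\<open>irregular_solid\<close> at the \<open>n\<close>-th
  vector is a constant times an inverse power of \<open>\<bar>2d + n\<bar>\<close>, and its angular factor depends only on
  the sign of \<open>2d + n\<close>. Since \<open>0 < 2d < 1\<close>, this sign is positive exactly for \<open>n \<ge> 0\<close>: the vector then
  points in the direction with azimuth \<open>\<pi>\<close>, and otherwise in that with azimuth \<open>0\<close>. Cutting the
  bilateral series at this sign change and substituting \<open>n = - k - 1\<close> in the negative half leaves two
  one-sided series, which are the two Lerch transcendents
  (\<open>irregular_solid_first_axis\<close>, \<open>bilateral_sums_of_halves\<close>).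

  The analytic content is the convergence of \<open>\<Sum>k. z\<^sup>k / (k + c)\<^sup>p\<close> on the unit circle
  (\<open>summable_lerch_on_circle\<close>). For \<open>p \<ge> 2\<close> it is absolute. For \<open>p = 1\<close>, the case \<open>l + l' = 0\<close>,
  it is conditional, needs \<open>z \<noteq> 1\<close>, and follows from summation by parts
  (\<open>summable_decreasing_times_power\<close>); with \<open>z = exp (\<plusminus>\<i>\<alpha>)\<close> this is where \<open>exp (\<i>\<alpha>) \<noteq> 1\<close> enters.
\<close>

section \<open>Series over the integers\<close>

lemma bilateral_sums_unique:
  assumes "bilateral_sums f S" "bilateral_sums f T"
  shows "S = T"
  using assms unfolding bilateral_sums_def
  by (intro tendsto_unique[of "sequentially \<times>\<^sub>F sequentially"]) (auto simp: prod_filter_eq_bot)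

text \<open>Each of the two cut-offs acts on one half only, so a limit along the product filter amounts to
  two independent limits of one-sided partial sums.\<close>

lemma bilateral_sums_of_halves:
  assumes nonneg: "(\<lambda>k. f (int k)) sums A" and neg: "(\<lambda>k. f (- int k - 1)) sums B"
  shows "bilateral_sums f (A + B)"
proof -
  have split: "(\<Sum>n = - int M..int N. f n) = (\<Sum>k\<le>N. f (int k)) + (\<Sum>k<M. f (- int k - 1))"
    for M N
  proof -
    have "{- int M..int N} = int ` {..N} \<union> (\<lambda>k. - int k - 1) ` {..<M}"
    proof (intro set_eqI iffI)
      fix n assume n: "n \<in> {- int M..int N}"
      show "n \<in> int ` {..N} \<union> (\<lambda>k. - int k - 1) ` {..<M}"
      proof (cases "0 \<le> n")
        case True
        then show ?thesis using n by (intro UnI1 image_eqI[of _ _ "nat n"]) auto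
      next
        case False
        then show ?thesis using n by (intro UnI2 image_eqI[of _ _ "nat (- n - 1)"]) auto
      qed
    qed auto
    moreover have "sum f (int ` {..N} \<union> (\<lambda>k. - int k - 1) ` {..<M}) =
        sum f (int ` {..N}) + sum f ((\<lambda>k. - int k - 1) ` {..<M})"
      by (rule sum.union_disjoint) auto
    ultimately show ?thesis
      by (simp add: sum.reindex inj_on_def)
  qed
  have "(\<lambda>N. \<Sum>k\<le>N. f (int k)) \<longlonglongrightarrow> A" "(\<lambda>M. \<Sum>k<M. f (- int k - 1)) \<longlonglongrightarrow> B"
    using nonneg unfolding sums_def_le using neg unfolding sums_def by blast+
  then have "((\<lambda>x. (\<Sum>k\<le>snd x. f (int k)) + (\<Sum>k<fst x. f (- int k - 1))) \<longlongrightarrow> A + B)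
      (sequentially \<times>\<^sub>F sequentially)"
    by (intro tendsto_add filterlim_compose[OF _ filterlim_snd] filterlim_compose[OF _ filterlim_fst])
  then show ?thesis
    unfolding bilateral_sums_def split by (simp add: case_prod_unfold)
qed

section \<open>Convergence of the Lerch series on the unit circle\<close>

text \<open>
  Summation by parts against the geometric partial sums, written without the partial sums: after
  multiplication by \<open>1 - z\<close> each term is a telescoping difference minus \<open>(b k - b (k + 1)) z\<^bsup>k+1\<^esup>\<close>,
  which is dominated by a telescoping series of nonnegative reals.
\<close>

lemma summable_decreasing_times_power:
  fixes b :: "nat \<Rightarrow> real" and z :: complex
  assumes dec: "decseq b" and lim: "b \<longlonglongrightarrow> 0" and z: "norm z \<le> 1" "z \<noteq> 1"
  shows "summable (\<lambda>k. of_real (b k) * z ^ k)"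
proof -
  let ?g = "\<lambda>k. of_real (b k) * z ^ k"
  have b_nonneg: "0 \<le> b k" for k
    using decseq_ge[OF dec lim] .
  have pow_le: "norm z ^ k \<le> 1" for k
    using z(1) by (simp add: power_le_one)
  have "?g \<longlonglongrightarrow> 0"
  proof (rule Lim_null_comparison[OF _ lim])
    show "\<forall>\<^sub>F k in sequentially. norm (?g k) \<le> b k"
      using b_nonneg pow_le by (auto simp: norm_mult norm_power intro!: always_eventually mult_left_le)
  qed
  then have telescoping: "summable (\<lambda>k. ?g k - ?g (Suc k))"
    by (rule telescope_summable')
  have remainder: "summable (\<lambda>k. of_real (b k - b (Suc k)) * z ^ Suc k)"
  proof (rule summable_comparison_test'[OF telescope_summable'[OF lim], of 0])
    fix k
    have "0 \<le> b k - b (Suc k)"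
      using dec by (simp add: decseq_SucD)
    then show "norm (of_real (b k - b (Suc k)) * z ^ Suc k) \<le> b k - b (Suc k)"
      using pow_le[of "Suc k"]
      by (simp add: norm_mult norm_power mult_left_le del: of_real_diff power_Suc)
  qed
  have "summable (\<lambda>k. (1 - z) * ?g k)"
    using summable_diff[OF telescoping remainder] by (simp add: algebra_simps)
  then show ?thesis
    using z(2) by (simp add: summable_cmult_iff)
qed

lemma summable_lerch_on_circle:
  fixes z :: complex
  assumes "0 < c" "norm z = 1" "p \<noteq> 0" and z: "p = 1 \<Longrightarrow> z \<noteq> 1"
  shows "summable (\<lambda>k. z ^ k / of_real ((real k + c) ^ p))"
proof (cases "p = 1")
  case True
  have "decseq (\<lambda>k. 1 / (real k + c))"
    using \<open>0 < c\<close> by (auto simp: decseq_def intro!: divide_left_mono)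
  moreover have "(\<lambda>k. 1 / (real k + c)) \<longlonglongrightarrow> 0"
    by real_asymp
  ultimately have "summable (\<lambda>k. of_real (1 / (real k + c)) * z ^ k)"
    using assms True by (intro summable_decreasing_times_power) auto
  then show ?thesis
    using True by (simp add: field_simps)
next
  case False
  then have "2 \<le> p" using \<open>p \<noteq> 0\<close> by simp
  show ?thesis
  proof (rule summable_comparison_test'[OF inverse_power_summable[OF \<open>2 \<le> p\<close>], of 1])
    fix k :: nat
    assume "1 \<le> k"
    then have "inverse ((real k + c) ^ p) \<le> inverse (real k ^ p)"
      using \<open>0 < c\<close> by (intro le_imp_inverse_le power_mono) auto
    then show "norm (z ^ k / of_real ((real k + c) ^ p)) \<le> inverse (real k ^ p)"
      using assms
      by (simp add: norm_divide norm_power inverse_eq_divide del: of_real_power of_real_add)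
  qed
qed

lemma sums_lerch_phi:
  assumes "0 < c" "norm z = 1" "p \<noteq> 0" "p = 1 \<Longrightarrow> z \<noteq> 1"
  shows "(\<lambda>k. z ^ k / of_real ((real k + c) ^ p)) sums lerch_phi z (of_nat p) (of_real c)"
proof -
  have "(of_nat k + of_real c) powr of_nat p = (of_real ((real k + c) ^ p) :: complex)" for k
    using \<open>p \<noteq> 0\<close> by (subst powr_nat') auto
  then show ?thesis
    using summable_sums[OF summable_lerch_on_circle[OF assms]] by (simp add: lerch_phi_def)
qed

section \<open>Irregular solid harmonics on the first axis\<close>

lemma irregular_solid_first_axis:
  assumes "x \<noteq> 0"
  shows "irregular_solid l m (vector [x, 0, 0]) =
    of_real (sqrt (4 * pi / (2 * real l + 1))) * sph_harm l m (pi / 2) (if x < 0 then pi else 0)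
      / of_real (\<bar>x\<bar> ^ (l + 1))"
proof -
  let ?v = "vector [x, 0, 0] :: real^3"
  have norm: "norm ?v = \<bar>x\<bar>"
    by (simp add: norm_vec_def L2_set_def sum_3)
  have "Arg (Complex (x / \<bar>x\<bar>) 0) = (if x < 0 then pi else 0)"
    using assms Arg_of_real[of "x / \<bar>x\<bar>"]
    by (simp add: complex_of_real_def divide_less_0_iff del: Arg_of_real)
  then have dir: "sph_harm_dir l m (?v /\<^sub>R norm ?v) = sph_harm l m (pi / 2) (if x < 0 then pi else 0)"
    by (simp add: sph_harm_dir_def norm inverse_eq_divide mult.commute)
  have "\<bar>x\<bar> powi (- int l - 1) = 1 / \<bar>x\<bar> ^ (l + 1)"
  proof -
    have "- int l - 1 = - int (l + 1)" by simp
    then show ?thesis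
      by (simp only: power_int_minus power_int_of_nat inverse_eq_divide)
  qed
  then show ?thesis
    unfolding irregular_solid_def dir unfolding norm by simp
qed

section \<open>The lattice sum\<close>

theorem lemmaA1:
  fixes d \<alpha> :: real and l l' :: nat and m \<mu> :: int
  assumes "0 < d" and "d < 1 / 2"
    and "\<bar>m\<bar> \<le> int l" and "\<bar>\<mu>\<bar> \<le> int l'"
    and "l + l' = 0 \<Longrightarrow> exp (\<i> * of_real \<alpha>) \<noteq> 1"
  shows "bilateral_summable (lattice_term d l l' m \<mu> \<alpha>) \<and>
    lattice_sum d l l' m \<mu> \<alpha> =
      (-1) powi (int l' + \<mu>)
      * of_real (sqrt ((2 * real l + 1) / (2 * real l' + 1)))
      * of_real (sqrt (real (nat (int l + int l' + \<mu> - m) choose nat (int l' + \<mu>))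
                     * real (nat (int l + int l' + m - \<mu>) choose nat (int l' - \<mu>))))
      * of_real (sqrt (4 * pi / (2 * real (l + l') + 1)))
      * (lerch_phi (exp (- \<i> * of_real \<alpha>)) (of_nat (l + l' + 1)) (of_real (2 * d))
           * sph_harm (l + l') (m - \<mu>) (pi / 2) pi
         + exp (\<i> * of_real \<alpha>)
           * lerch_phi (exp (\<i> * of_real \<alpha>)) (of_nat (l + l' + 1)) (of_real (1 - 2 * d))
           * sph_harm (l + l') (m - \<mu>) (pi / 2) 0)"
proof -
  define p where "p = l + l' + 1"
  define z where "z = exp (\<i> * of_real \<alpha>)"
  define K where "K = (-1) powi (int l' + \<mu>)
      * of_real (sqrt ((2 * real l + 1) / (2 * real l' + 1)))
      * of_real (sqrt (real (nat (int l + int l' + \<mu> - m) choose nat (int l' + \<mu>))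
                     * real (nat (int l + int l' + m - \<mu>) choose nat (int l' - \<mu>))))
      * (of_real (sqrt (4 * pi / (2 * real (l + l') + 1))) :: complex)"
  define Y where "Y \<phi> = sph_harm (l + l') (m - \<mu>) (pi / 2) \<phi>" for \<phi>
  define f where "f = lattice_term d l l' m \<mu> \<alpha>"
  define \<Phi>0 where "\<Phi>0 = lerch_phi (inverse z) (of_nat p) (of_real (2 * d))"
  define \<Phi>1 where "\<Phi>1 = lerch_phi z (of_nat p) (of_real (1 - 2 * d))"

  have z_inverse: "exp (- \<i> * of_real \<alpha>) = inverse z"
    by (simp add: z_def exp_minus)
  have z_norm: "norm z = 1" "norm (inverse z) = 1"
    by (simp_all add: z_def norm_inverse)
  have z_not_1: "z \<noteq> 1" "inverse z \<noteq> 1" if "p = 1"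
    using assms(5) that by (auto simp: p_def z_def)

  have lattice_term: "f n = K * Y (if 2 * d + of_int n > 0 then pi else 0)
      / of_real (\<bar>2 * d + of_int n\<bar> ^ p) * exp (- \<i> * of_int n * of_real \<alpha>)"
    if "2 * d + of_int n \<noteq> 0" for n
    using irregular_solid_first_axis[of "- (2 * d + of_int n)" "l + l'" "m - \<mu>"] that
    by (simp add: f_def lattice_term_def translation_coeff_def b21_def K_def Y_def p_def mult_ac add_ac
        del: of_real_power of_real_add of_real_mult of_real_diff of_real_minus)

  have nonneg_term: "f (int k) = K * Y pi * (inverse z ^ k / of_real ((real k + 2 * d) ^ p))" for k
  proof -
    have "exp (- \<i> * of_int (int k) * of_real \<alpha>) = inverse z ^ k"
      by (simp add: z_inverse[symmetric] exp_of_nat_mult[symmetric] mult_ac)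
    then show ?thesis
      using assms(1) lattice_term[of "int k"] by (simp add: add_ac add_pos_nonneg)
  qed
  have neg_term: "f (- int k - 1) = K * z * Y 0 * (z ^ k / of_real ((real k + (1 - 2 * d)) ^ p))" for k
  proof -
    have "exp (- \<i> * of_int (- int k - 1) * of_real \<alpha>) = z ^ Suc k"
      unfolding z_def by (subst exp_of_nat_mult[symmetric]) (simp add: algebra_simps)
    moreover have "2 * d + of_int (- int k - 1) < 0"
      using assms(2) by simp
    moreover have "\<bar>2 * d + of_int (- int k - 1)\<bar> = real k + (1 - 2 * d)"
      using assms(2) by simp
    ultimately show ?thesis
      using lattice_term[of "- int k - 1"] by (simp add: mult_ac add_ac add_diff_eq)
  qed

  have "(\<lambda>k. f (int k)) sums (K * Y pi * \<Phi>0)"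
    unfolding nonneg_term \<Phi>0_def using assms(1) z_norm z_not_1
    by (intro sums_mult sums_lerch_phi) (auto simp: p_def)
  moreover have "(\<lambda>k. f (- int k - 1)) sums (K * z * Y 0 * \<Phi>1)"
    unfolding neg_term \<Phi>1_def using assms(2) z_norm z_not_1
    by (intro sums_mult sums_lerch_phi) (auto simp: p_def)
  ultimately have sums: "bilateral_sums f (K * Y pi * \<Phi>0 + K * z * Y 0 * \<Phi>1)"
    by (rule bilateral_sums_of_halves)
  then have "bilateral_suminf f = K * (\<Phi>0 * Y pi + z * \<Phi>1 * Y 0)"
    unfolding bilateral_suminf_def
    by (subst the_equality[where a = "K * Y pi * \<Phi>0 + K * z * Y 0 * \<Phi>1"])
      (auto intro: bilateral_sums_unique simp: algebra_simps)
  moreover have "bilateral_summable f"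
    using sums by (auto simp: bilateral_summable_def)
  ultimately show ?thesis
    unfolding lattice_sum_def f_def K_def \<Phi>0_def \<Phi>1_def Y_def p_def z_inverse[symmetric]
    by (simp only: z_def)
qed

end
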